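(* Let $D\subset\mathbb{C}$ be a hyperbolic plane domain, let $-\infty<a<b\leq\infty$, let $G=S(a,b)=(a,b)\times\mathbb{R}=\{w\in\mathbb{C}: a<\operatorname{Re}w<b\}$, and let $f:D\rightarrow G$ be a complex-valued harmonic function. Let $z\in D$, let $h\in T_z\mathbb{C}$ with $|h|=1$, and suppose $df_z(h)=\lambda v$ with $\lambda>0$ and $v\in T_{f(z)}\mathbb{C}$, $|v|=1$. Let $\alpha$ be the measure of the angle between $v$ and $e_1$. Then: (I) $\lambda\cos\alpha\;\mathrm{Hyp}_G(f(z))\leq\mathrm{Hyp}_D(z)$. (II) If $f$ is real-valued, then $\lambda\,\mathrm{Hyp}_G(f(z))\leq\mathrm{Hyp}_D(z)$. Hence, for real-valued $f$, $\mathrm{Hyp}_G(f(z_1),f(z_2))\leq\mathrm{Hyp}_D(z_1,z_2)$ for all $z_1,z_2\in D$.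
   Context: A complex-valued function is harmonic if its real and imaginary parts are real harmonic functions; $df_z$ is its real differential at $z$, a real-linear map $T_z\mathbb{C}\to T_{f(z)}\mathbb{C}$, with tangent spaces identified with $\mathbb{C}\cong\mathbb{R}^2$. The vector $e_1=e_1(f(z))\in T_{f(z)}\mathbb{C}$ is the unit vector in the direction of the positive real axis. A plane domain $D$ is hyperbolic if its holomorphic universal covering is the unit disk $\mathbb{D}$. The hyperbolic density is normalized to have Gaussian curvature $-1$: $\mathrm{Hyp}_{\mathbb{D}}(z)=\frac{2}{1-|z|^2}$, and on a hyperbolic domain $D$ with holomorphic universal covering $\pi:\mathbb{D}\to D$ it is determined by $\mathrm{Hyp}_D(\pi(z))|\pi'(z)|=\mathrm{Hyp}_{\mathbb{D}}(z)$. With one argument $\mathrm{Hyp}_D(z)$ is this density; with two arguments $\mathrm{Hyp}_D(z_1,z_2)$ is the hyperbolic distance, i.e. the infimum of $\int_\gamma\mathrm{Hyp}_D(z)\,|dz|$ over all piecewise smooth paths $\gamma$ in $D$ joining $z_1$ and $z_2$. *)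

theory Defs
  imports "HOL-Analysis.Analysis"
begin

definition dirderiv :: "complex \<Rightarrow> (complex \<Rightarrow> real) \<Rightarrow> complex \<Rightarrow> real" where
  "dirderiv v u z = frechet_derivative u (at z) v"

definition real_harmonic_on :: "(complex \<Rightarrow> real) \<Rightarrow> complex set \<Rightarrow> bool" where
  "real_harmonic_on u D \<longleftrightarrow>
     u differentiable_on D \<and>
     (\<forall>v\<in>{1, \<i>}. dirderiv v u differentiable_on D \<and>
        (\<forall>w\<in>{1, \<i>}. continuous_on D (dirderiv w (dirderiv v u)))) \<and>
     (\<forall>z\<in>D. dirderiv 1 (dirderiv 1 u) z + dirderiv \<i> (dirderiv \<i> u) z = 0)"
  \<comment> \<open>Intended for open \<open>D\<close>. The first two conjuncts say that \<open>u\<close> is twice continuously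
      differentiable on \<open>D\<close>; they also ensure that every derivative occurring in the
      Laplacian exists.\<close>

definition complex_harmonic_on :: "(complex \<Rightarrow> complex) \<Rightarrow> complex set \<Rightarrow> bool" where
  "complex_harmonic_on f D \<longleftrightarrow>
     real_harmonic_on (\<lambda>z. Re (f z)) D \<and> real_harmonic_on (\<lambda>z. Im (f z)) D"

definition vec_angle :: "complex \<Rightarrow> complex \<Rightarrow> real" where
  "vec_angle v w = arccos ((v \<bullet> w) / (norm v * norm w))"

definition strip :: "real \<Rightarrow> ereal \<Rightarrow> complex set" where
  "strip a b = {w. a < Re w \<and> ereal (Re w) < b}"

text \<open>A covering by the unit disc is automatically universal, the disc being simply connected.\<close>

definition disc_covering :: "(complex \<Rightarrow> complex) \<Rightarrow> complex set \<Rightarrow> bool" where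
  "disc_covering p D \<longleftrightarrow> p holomorphic_on ball 0 1 \<and> covering_space (ball 0 1) p D"

definition hyperbolic_domain :: "complex set \<Rightarrow> bool" where
  "hyperbolic_domain D \<longleftrightarrow> open D \<and> connected D \<and> (\<exists>p. disc_covering p D)"

definition disc_density :: "complex \<Rightarrow> real" where
  "disc_density z = 2 / (1 - (norm z)\<^sup>2)"

text \<open>For a hyperbolic domain \<open>D\<close> and \<open>w \<in> D\<close> exactly one \<open>r\<close> satisfies the condition below:
  by the Schwarz--Pick lemma it depends neither on the covering nor on the preimage of \<open>w\<close>.\<close>

definition hyp_density :: "complex set \<Rightarrow> complex \<Rightarrow> real" where
  "hyp_density D w =
     (THE r. \<forall>p z. disc_covering p D \<and> z \<in> ball 0 1 \<and> p z = w \<longrightarrow>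
               r * norm (deriv p z) = disc_density z)"

text \<open>Unlike \<^const>\<open>valid_path\<close>, the following demands one-sided derivatives at the break points.
  A \<^const>\<open>valid_path\<close> may have infinite length, in which case the integral in \<open>hyp_length\<close>
  would by convention be 0 and the infimum in \<open>hyp_dist\<close> would collapse.\<close>

definition piecewise_smooth_path :: "(real \<Rightarrow> complex) \<Rightarrow> bool" where
  "piecewise_smooth_path g \<longleftrightarrow>
     (\<exists>(n::nat) t. t 0 = 0 \<and> t n = 1 \<and> (\<forall>i<n. t i < t (Suc i)) \<and>
        (\<forall>i<n. \<exists>g'. continuous_on {t i..t (Suc i)} g' \<and>
           (\<forall>x\<in>{t i..t (Suc i)}.
              (g has_vector_derivative g' x) (at x within {t i..t (Suc i)}))))"

definition hyp_length :: "complex set \<Rightarrow> (real \<Rightarrow> complex) \<Rightarrow> real" where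
  "hyp_length D g =
     integral {0..1} (\<lambda>t. hyp_density D (g t) * norm (vector_derivative g (at t within {0..1})))"

definition hyp_dist :: "complex set \<Rightarrow> complex \<Rightarrow> complex \<Rightarrow> real" where
  "hyp_dist D z1 z2 =
     (INF g \<in> {g. piecewise_smooth_path g \<and> path_image g \<subseteq> D \<and>
                  pathstart g = z1 \<and> pathfinish g = z2}. hyp_length D g)"

end

theory Submission
  imports Defs "HOL-Complex_Analysis.Complex_Analysis"
begin

text \<open>
  Let \<open>p\<close> be a covering of \<open>D\<close> by the disc and \<open>u = Re f\<close>. The function \<open>u\<^sub>x - \<i> u\<^sub>y\<close> is
  holomorphic on \<open>D\<close>, and pulling it back along \<open>p\<close> and integrating gives a holomorphic \<open>F\<close> on the
  disc with \<open>Re F = u \<circ> p\<close>, whose imaginary part can be normalised so that \<open>F\<close> hits \<open>f z\<close>.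
  As \<open>F\<close> maps into the strip, it lifts through a covering of the strip by the disc, and the
  Schwarz--Pick lemma bounds \<open>|F'|\<close>, which is \<open>|\<nabla>u| |p'|\<close>. Only \<open>Re (df(h)) = du(h)\<close> is controlled
  in this way; that is the factor \<open>cos \<alpha>\<close>. The distance estimate follows by integrating along paths.
\<close>

section \<open>The Schwarz--Pick lemma for the disc\<close>

lemma disc_density_pos: "z \<in> ball 0 1 \<Longrightarrow> disc_density z > 0"
  by (simp add: disc_density_def abs_square_less_1)

text \<open>The value is \<open>disc_density w / 2\<close>. In Schwarz--Pick it is the chain-rule
  factor on the image side; the derivative at 0 of the inverse map supplies the reciprocal factor on
  the source side.\<close>

lemma has_field_derivative_Moebius_self:
  assumes "norm w < 1"
  shows "(Moebius_function 0 w has_field_derivative 1 / of_real (1 - (norm w)\<^sup>2)) (at w)"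
proof -
  have e: "1 - cnj w * w = of_real (1 - (norm w)\<^sup>2)"
    by (simp add: complex_norm_square[symmetric] mult.commute)
  have nz: "1 - (norm w)\<^sup>2 \<noteq> 0"
    using assms abs_square_less_1[of "norm w"] by simp
  hence nz': "1 - cnj w * w \<noteq> 0"
    unfolding e by (metis of_real_eq_0_iff)
  have "((\<lambda>z. (z - w) / (1 - cnj w * z)) has_field_derivative 1 / (1 - cnj w * w)) (at w)"
    by (rule derivative_eq_intros refl nz' | simp)+
  then show ?thesis
    unfolding e by (simp add: Moebius_function_simple[abs_def])
qed

lemma has_field_derivative_Moebius_uminus_0:
  "(Moebius_function 0 (- w) has_field_derivative of_real (1 - (norm w)\<^sup>2)) (at 0)"
proof -
  have "((\<lambda>z. (z + w) / (1 + cnj w * z)) has_field_derivative 1 - w * cnj w) (at 0)"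
    by (auto intro!: derivative_eq_intros)
  moreover have "1 - w * cnj w = of_real (1 - (norm w)\<^sup>2)"
    by (simp add: complex_norm_square[symmetric])
  ultimately show ?thesis
    by (simp add: Moebius_function_simple[abs_def])
qed

text \<open>Moebius maps reduce this to the Schwarz lemma at the origin: \<open>?m\<close> takes 0
  to \<open>z\<close> and \<open>?n\<close> takes \<open>g z\<close> to 0, so \<open>k\<close> is a
  self-map of the disc fixing 0 and \<open>|k'(0)| \<le> 1\<close>. Expanding \<open>k'(0)\<close>
  by the chain rule gives the two densities.\<close>

lemma Schwarz_Pick:
  assumes g: "g holomorphic_on ball 0 1" "g ` ball 0 1 \<subseteq> ball 0 1" and z: "z \<in> ball 0 1"
  shows "norm (deriv g z) * disc_density (g z) \<le> disc_density z"
proof -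
  let ?m = "Moebius_function 0 (- z)" and ?n = "Moebius_function 0 (g z)"
  define k where "k = ?n \<circ> g \<circ> ?m"
  have nz: "norm z < 1" "norm (- z) < 1" and ng: "norm (g z) < 1"
    using g z by (auto simp: image_subset_iff)
  have m: "?m holomorphic_on ball 0 1" "?m ` ball 0 1 \<subseteq> ball 0 1" "?m 0 = z"
    using nz by (auto simp: Moebius_function_holomorphic Moebius_function_norm_lt_1 Moebius_function_of_zero)
  have "k holomorphic_on ball 0 1"
    unfolding k_def using m g Moebius_function_holomorphic[OF ng]
    by (intro holomorphic_on_compose_gen[where t="ball 0 1"]) auto
  moreover have "k 0 = 0"
    by (simp add: k_def m Moebius_function_eq_zero)
  moreover have "norm (k x) < 1" if "norm x < 1" for x
    using Moebius_function_norm_lt_1[OF ng] m g that by (auto simp: k_def image_subset_iff)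
  ultimately have le: "norm (deriv k 0) \<le> 1"
    by (rule Schwarz_Lemma(2)[where \<xi>=0]) auto
  have "(g has_field_derivative deriv g (?m 0)) (at (?m 0))"
    using holomorphic_derivI[OF g(1) open_ball z] m(3) by simp
  then have "(g \<circ> ?m has_field_derivative deriv g (?m 0) * of_real (1 - (norm z)\<^sup>2)) (at 0)"
    by (rule DERIV_chain) (rule has_field_derivative_Moebius_uminus_0)
  moreover have "(?n has_field_derivative 1 / of_real (1 - (norm (g z))\<^sup>2)) (at ((g \<circ> ?m) 0))"
    using has_field_derivative_Moebius_self[OF ng] m(3) by simp
  ultimately have "(k has_field_derivative
      1 / of_real (1 - (norm (g z))\<^sup>2) * (deriv g (?m 0) * of_real (1 - (norm z)\<^sup>2))) (at 0)"
    unfolding k_def comp_assoc by (rule DERIV_chain[rotated])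
  then have "deriv k 0 = of_real (1 / (1 - (norm (g z))\<^sup>2) * (1 - (norm z)\<^sup>2)) * deriv g z"
    by (simp add: DERIV_imp_deriv m(3))
  moreover have pos: "1 - (norm z)\<^sup>2 > 0" "1 - (norm (g z))\<^sup>2 > 0"
    using nz ng by (auto simp: abs_square_less_1)
  ultimately have "norm (deriv k 0) = 1 / (1 - (norm (g z))\<^sup>2) * (1 - (norm z)\<^sup>2) * norm (deriv g z)"
    by (simp only: norm_mult norm_of_real) simp
  with le pos show ?thesis
    by (simp add: disc_density_def field_simps)
qed

section \<open>Disc coverings and the hyperbolic density\<close>

lemma disc_coveringD:
  assumes "disc_covering p D"
  shows "p holomorphic_on ball 0 1" "covering_space (ball 0 1) p D" "p ` ball 0 1 = D"
  using assms by (auto simp: disc_covering_def covering_space_imp_surjective)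

text \<open>A covering map is locally injective, and an injective holomorphic function has no
  critical point.\<close>

lemma deriv_disc_covering_nonzero:
  assumes p: "disc_covering p D" and z: "z \<in> ball 0 1"
  shows "deriv p z \<noteq> 0"
proof -
  obtain T u q where T: "z \<in> T" "openin (top_of_set (ball 0 1)) T"
    and h: "homeomorphism T u p q"
    by (rule covering_space_local_homeomorphism[OF disc_coveringD(2)[OF p] z])
  have "open T" "T \<subseteq> ball 0 1"
    by (rule openin_open_trans[OF T(2) open_ball], rule openin_imp_subset[OF T(2)])
  moreover have "inj_on p T"
    using h by (intro inj_on_inverseI[of _ q]) (simp add: homeomorphism_def)
  ultimately show ?thesis
    using holomorphic_injective_imp_regular[of p T z] T(1)
      holomorphic_on_subset[OF disc_coveringD(1)[OF p]] by simp
qed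

text \<open>The disc is simply connected, so \<open>F\<close> lifts through \<open>q\<close> to a
  holomorphic self-map \<open>g\<close> of the disc with \<open>g z = w\<close>, and Schwarz--Pick
  applies to \<open>g\<close>. The estimate is phrased with \<open>q\<close> and \<open>w\<close>
  instead of \<open>hyp_density D\<close>, since it is what shows that density to be well
  defined.\<close>

lemma disc_covering_contraction:
  assumes F: "F holomorphic_on ball 0 1" "F ` ball 0 1 \<subseteq> D"
    and q: "disc_covering q D" and z: "z \<in> ball 0 1" and w: "w \<in> ball 0 1" and eq: "F z = q w"
  shows "norm (deriv F z) * disc_density w \<le> disc_density z * norm (deriv q w)"
proof -
  note q' = disc_coveringD[OF q]
  have *: "simply_connected (ball (0::complex) 1)" "locally path_connected (ball (0::complex) 1)"
    by (simp_all add: convex_imp_simply_connected convex_imp_locally_path_connected)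
  have "F \<in> ball 0 1 \<rightarrow> D" using F by auto
  with covering_space_lift_strong[OF q'(2) w z * holomorphic_on_imp_continuous_on[OF F(1)] _ eq]
  obtain g where g: "continuous_on (ball 0 1) g" "g \<in> ball 0 1 \<rightarrow> ball 0 1" "g z = w"
    and qg: "\<And>y. y \<in> ball 0 1 \<Longrightarrow> q (g y) = F y"
    by metis
  have holg: "g holomorphic_on ball 0 1"
    by (rule covering_space_lift_is_holomorphic[OF q'(2) open_ball q'(1) F(1) \<open>F \<in> _\<close> g(2,1) qg])
  have "(q has_field_derivative deriv q w) (at (g z))"
    using holomorphic_derivI[OF q'(1) open_ball w] g by simp
  moreover have "(g has_field_derivative deriv g z) (at z)"
    using holomorphic_derivI[OF holg open_ball z] .
  ultimately have "(q \<circ> g has_field_derivative deriv q w * deriv g z) (at z)"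
    by (rule DERIV_chain)
  then have "(F has_field_derivative deriv q w * deriv g z) (at z)"
    by (rule has_field_derivative_transform_within_open[OF _ open_ball z]) (simp add: qg)
  then have "deriv F z = deriv q w * deriv g z"
    by (rule DERIV_imp_deriv)
  moreover have "norm (deriv g z) * disc_density w \<le> disc_density z"
    using Schwarz_Pick[OF holg _ z] g by auto
  from mult_right_mono[OF this, of "norm (deriv q w)"]
  have "norm (deriv q w) * norm (deriv g z) * disc_density w \<le> disc_density z * norm (deriv q w)"
    by (simp add: mult_ac)
  ultimately show ?thesis
    by (simp add: norm_mult)
qed

text \<open>This justifies the \<open>THE\<close> in \<open>hyp_density\<close>. Coverings
  \<open>p\<close> and \<open>q\<close> with a common value lift through each other, so the
  contraction estimate holds in both directions and becomes an equality.\<close>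

lemma hyp_density_disc_covering:
  assumes p: "disc_covering p D" and z: "z \<in> ball 0 1"
  shows "hyp_density D (p z) = disc_density z / norm (deriv p z)"
  unfolding hyp_density_def
proof (rule the_equality)
  have d: "norm (deriv q w) > 0" if "disc_covering q D" "w \<in> ball 0 1" for q w
    using deriv_disc_covering_nonzero[OF that(1) that(2)] by simp
  show "\<forall>q w. disc_covering q D \<and> w \<in> ball 0 1 \<and> q w = p z \<longrightarrow>
      disc_density z / norm (deriv p z) * norm (deriv q w) = disc_density w"
  proof (intro allI impI, elim conjE)
    fix q w assume q: "disc_covering q D" and w: "w \<in> ball 0 1" and eq: "q w = p z"
    have "norm (deriv p z) * disc_density w \<le> disc_density z * norm (deriv q w)"
      using disc_covering_contraction[where F=p, OF _ _ q z w eq[symmetric]] disc_coveringD[OF p] by blast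
    moreover have "norm (deriv q w) * disc_density z \<le> disc_density w * norm (deriv p z)"
      using disc_covering_contraction[where F=q, OF _ _ p w z eq] disc_coveringD[OF q] by blast
    ultimately show "disc_density z / norm (deriv p z) * norm (deriv q w) = disc_density w"
      using d[OF p z] by (simp add: field_simps)
  qed
  \<comment> \<open>Uniqueness: the condition on \<open>r\<close>, taken at \<open>p\<close> and
    \<open>z\<close> themselves, determines \<open>r\<close> because \<open>deriv p z\<close> does
    not vanish.\<close>
  show "r = disc_density z / norm (deriv p z)"
    if "\<forall>q w. disc_covering q D \<and> w \<in> ball 0 1 \<and> q w = p z \<longrightarrow>
      r * norm (deriv q w) = disc_density w" for r
    using that p z d[OF p z] by (metis nonzero_eq_divide_eq order_less_irrefl)
qed

text \<open>Dividing the lifting estimate by \<open>norm (deriv q w)\<close>, at a point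
  \<open>w\<close> lying over \<open>F z\<close>, turns the density of the disc on its left-hand
  side into that of \<open>D\<close>.\<close>

lemma hyp_density_contraction:
  assumes F: "F holomorphic_on ball 0 1" "F ` ball 0 1 \<subseteq> D"
    and D: "hyperbolic_domain D" and z: "z \<in> ball 0 1"
  shows "norm (deriv F z) * hyp_density D (F z) \<le> disc_density z"
proof -
  obtain q where q: "disc_covering q D"
    using D by (auto simp: hyperbolic_domain_def)
  obtain w where w: "w \<in> ball 0 1" "F z = q w"
    using F(2) z disc_coveringD(3)[OF q] by (metis image_iff image_subset_iff)
  have "norm (deriv F z) * disc_density w / norm (deriv q w) \<le> disc_density z"
    using disc_covering_contraction[OF F q z w] deriv_disc_covering_nonzero[OF q w(1)]
    by (simp add: pos_divide_le_eq)
  then show ?thesis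
    by (simp add: w(2) hyp_density_disc_covering[OF q w(1)])
qed

lemma hyp_density_pos:
  assumes D: "hyperbolic_domain D" and "w \<in> D"
  shows "hyp_density D w > 0"
proof -
  obtain q where q: "disc_covering q D"
    using D by (auto simp: hyperbolic_domain_def)
  then obtain z where "z \<in> ball 0 1" "w = q z"
    using \<open>w \<in> D\<close> disc_coveringD(3)[OF q] by blast
  then show ?thesis
    using hyp_density_disc_covering[OF q] deriv_disc_covering_nonzero[OF q]
      disc_density_pos by simp
qed

text \<open>After composition with \<open>q\<close> the density is continuous by its explicit
  formula. This descends to \<open>D\<close> because a covering map is open: the preimage of an open
  set in \<open>D\<close> is the \<open>q\<close>-image of its open preimage in the disc.\<close>

lemma continuous_on_hyp_density:
  assumes D: "hyperbolic_domain D"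
  shows "continuous_on D (hyp_density D)"
proof -
  obtain q where q: "disc_covering q D" and "open D"
    using D by (auto simp: hyperbolic_domain_def)
  note q' = disc_coveringD[OF q]
  have nz: "\<And>z. z \<in> ball 0 1 \<Longrightarrow> deriv q z \<noteq> 0"
    using deriv_disc_covering_nonzero[OF q] .
  have "continuous_on (ball 0 1) (\<lambda>z. disc_density z / norm (deriv q z))"
    unfolding disc_density_def using nz
    by (intro continuous_intros holomorphic_on_imp_continuous_on holomorphic_deriv q')
       (auto simp: abs_square_eq_1)
  then have c: "continuous_on (ball 0 1) (\<lambda>z. hyp_density D (q z))"
    by (rule continuous_on_eq) (simp add: hyp_density_disc_covering[OF q])
  show ?thesis
    unfolding continuous_on_open_vimage[OF \<open>open D\<close>]
  proof (intro allI impI)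
    fix B :: "real set" assume "open B"
    have "openin (top_of_set (ball 0 1)) (ball 0 1 \<inter> (\<lambda>z. hyp_density D (q z)) -` B)"
      using c \<open>open B\<close> by (rule continuous_openin_preimage_gen)
    then have "openin (top_of_set D) (q ` (ball 0 1 \<inter> (\<lambda>z. hyp_density D (q z)) -` B))"
      by (rule covering_space_open_map[OF q'(2)])
    moreover have "q ` (ball 0 1 \<inter> (\<lambda>z. hyp_density D (q z)) -` B) = hyp_density D -` B \<inter> D"
      using q'(3) by auto
    ultimately show "open (hyp_density D -` B \<inter> D)"
      using \<open>open D\<close> openin_open_trans by fastforce
  qed
qed

section \<open>Hyperbolicity of the strip\<close>

text \<open>The inverse of a Riemann map is a holomorphic homeomorphism from the disc, hence a
  covering.\<close>

lemma hyperbolic_domain_simply_connected: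
  assumes "open S" "simply_connected S" "S \<noteq> {}" "S \<noteq> UNIV"
  shows "hyperbolic_domain S"
proof -
  obtain f g where fg: "f holomorphic_on S" "g holomorphic_on ball 0 1"
    "\<And>z. z \<in> S \<Longrightarrow> f z \<in> ball 0 1 \<and> g (f z) = z"
    "\<And>z. z \<in> ball 0 1 \<Longrightarrow> g z \<in> S \<and> f (g z) = z"
    using Riemann_mapping_theorem[of S] assms by metis
  have "homeomorphism (ball 0 1) S g f"
    using fg by (intro homeomorphismI holomorphic_on_imp_continuous_on) blast+
  then have "disc_covering g S"
    using fg(2) by (simp add: disc_covering_def homeomorphism_imp_covering_space)
  then show ?thesis
    using assms by (auto simp: hyperbolic_domain_def simply_connected_imp_connected)
qed

lemma hyperbolic_domain_strip:
  assumes "ereal a < b"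
  shows "hyperbolic_domain (strip a b)"
proof (rule hyperbolic_domain_simply_connected)
  \<comment> \<open>A half-plane or an intersection of two half-planes, according to whether
    \<open>b\<close> is infinite.\<close>
  have eq: "strip a b = {w. Re w > a} \<inter> (if b = \<infinity> then UNIV else {w. Re w < real_of_ereal b})"
    using assms by (cases b) (auto simp: strip_def)
  show "open (strip a b)"
    unfolding eq by (simp add: open_halfspace_Re_gt open_halfspace_Re_lt open_Int)
  have "convex (strip a b)"
    unfolding eq by (simp add: convex_halfspace_Re_gt convex_halfspace_Re_lt convex_Int)
  then show "simply_connected (strip a b)"
    by (rule convex_imp_simply_connected)
  obtain x where "ereal a < ereal x" "ereal x < b"
    using assms ereal_dense2 by blast
  then have "complex_of_real x \<in> strip a b"
    by (auto simp: strip_def)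
  then show "strip a b \<noteq> {}" by blast
  have "complex_of_real a \<notin> strip a b"
    by (auto simp: strip_def)
  then show "strip a b \<noteq> UNIV" by blast
qed

section \<open>Directional derivatives and symmetry of mixed second derivatives\<close>

lemma has_real_derivative_dirderiv:
  assumes "u differentiable (at (c + of_real t * v))"
  shows "((\<lambda>t. u (c + of_real t * v)) has_real_derivative dirderiv v u (c + of_real t * v)) (at t)"
proof -
  let ?L = "frechet_derivative u (at (c + of_real t * v))"
  have u: "(u has_derivative ?L) (at (c + of_real t * v))"
    using assms by (simp add: frechet_derivative_works)
  have "((\<lambda>t. c + of_real t * v) has_derivative (\<lambda>s. of_real s * v)) (at t)"
    by (auto intro!: derivative_eq_intros)
  from has_derivative_compose[OF this u]
  have "((\<lambda>t. u (c + of_real t * v)) has_derivative (\<lambda>s. ?L (of_real s * v))) (at t)" .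
  moreover have "?L (of_real s * v) = s * ?L v" for s
    using linear_scale[OF has_derivative_linear[OF u], of s v] by (simp add: scaleR_conv_of_real)
  ultimately show ?thesis
    by (simp add: has_field_derivative_def dirderiv_def mult.commute[of "?L v", abs_def])
qed

text \<open>The mean value theorem is used twice: along \<open>v\<close> for the difference of
  \<open>u\<close> over a step in direction \<open>w\<close>, then along \<open>w\<close> for
  \<open>dirderiv v u\<close>. The second difference is symmetric in \<open>v\<close> and
  \<open>w\<close>, which is what allows derivatives to be swapped.\<close>

lemma second_difference_mvt:
  fixes u :: "complex \<Rightarrow> real"
  assumes u: "\<And>y. y \<in> ball z d \<Longrightarrow> u differentiable (at y)"
    and u': "\<And>y. y \<in> ball z d \<Longrightarrow> dirderiv v u differentiable (at y)"
    and r: "r > 0" "r * norm v + r * norm w < d"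
  obtains y where "y \<in> ball z d"
    "u (z + of_real r * v + of_real r * w) - u (z + of_real r * v) - u (z + of_real r * w) + u z
       = r\<^sup>2 * dirderiv w (dirderiv v u) y"
proof -
  have mem: "z + of_real t * w + of_real s * v \<in> ball z d" "z + of_real s * v + of_real t * w \<in> ball z d"
    if "0 \<le> s" "s \<le> r" "0 \<le> t" "t \<le> r" for s t
  proof -
    have "norm (of_real t * w + of_real s * v) \<le> r * norm w + r * norm v"
      using that by (intro norm_triangle_mono) (auto simp: norm_mult intro: mult_right_mono)
    also have "\<dots> < d" using r by simp
    finally show "z + of_real t * w + of_real s * v \<in> ball z d" "z + of_real s * v + of_real t * w \<in> ball z d"
      by (auto simp: dist_norm norm_minus_commute add.commute add.left_commute)
  qed
  define \<phi> where "\<phi> s = u ((z + of_real r * w) + of_real s * v) - u (z + of_real s * v)" for s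
  have "\<exists>s. 0 < s \<and> s < r \<and> \<phi> r - \<phi> 0 = (r - 0) *
      (dirderiv v u ((z + of_real r * w) + of_real s * v) - dirderiv v u (z + of_real s * v))"
    unfolding \<phi>_def using mem(1)[of _ r] mem(1)[of _ 0] r
    by (intro MVT2 r derivative_intros has_real_derivative_dirderiv u) auto
  then obtain s where s: "0 < s" "s < r" and e1: "\<phi> r - \<phi> 0 = r *
      (dirderiv v u ((z + of_real r * w) + of_real s * v) - dirderiv v u (z + of_real s * v))"
    by auto
  \<comment> \<open>The derivative of \<open>\<phi>\<close> at the intermediate point
    \<open>s\<close> is \<open>\<psi> r - \<psi> 0\<close>.\<close>
  define \<psi> where "\<psi> t = dirderiv v u ((z + of_real s * v) + of_real t * w)" for t
  have "\<exists>t. 0 < t \<and> t < r \<and> \<psi> r - \<psi> 0 = (r - 0) *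
      dirderiv w (dirderiv v u) ((z + of_real s * v) + of_real t * w)"
    unfolding \<psi>_def using mem(2)[of s] r s
    by (intro MVT2 r derivative_intros has_real_derivative_dirderiv u') auto
  then obtain t where t: "0 < t" "t < r" and e2: "\<psi> r - \<psi> 0 = r *
      dirderiv w (dirderiv v u) ((z + of_real s * v) + of_real t * w)"
    by auto
  have "\<phi> r - \<phi> 0 = r * (\<psi> r - \<psi> 0)"
    unfolding e1 \<psi>_def by (simp add: add_ac)
  then have "u (z + of_real r * v + of_real r * w) - u (z + of_real r * v) - u (z + of_real r * w) + u z
       = r\<^sup>2 * dirderiv w (dirderiv v u) ((z + of_real s * v) + of_real t * w)"
    unfolding e2 by (simp add: \<phi>_def power2_eq_square add_ac)
  then show thesis
    using that mem(2)[of s t] s t by auto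
qed

text \<open>By symmetry of the second difference, every small ball around \<open>z\<close> contains
  points \<open>y1\<close>, \<open>y2\<close> at which the two mixed derivatives take a common
  value; continuity at \<open>z\<close> carries the agreement over to \<open>z\<close>.\<close>

lemma dirderiv_commute:
  fixes u :: "complex \<Rightarrow> real"
  assumes "open D" "z \<in> D"
    and u: "\<And>y. y \<in> D \<Longrightarrow> u differentiable (at y)"
    and uv: "\<And>y. y \<in> D \<Longrightarrow> dirderiv v u differentiable (at y)"
    and uw: "\<And>y. y \<in> D \<Longrightarrow> dirderiv w u differentiable (at y)"
    and cont: "continuous_on D (dirderiv w (dirderiv v u))" "continuous_on D (dirderiv v (dirderiv w u))"
  shows "dirderiv w (dirderiv v u) z = dirderiv v (dirderiv w u) z"
proof (rule ccontr)
  let ?A = "dirderiv w (dirderiv v u)" and ?B = "dirderiv v (dirderiv w u)"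
  assume ne: "?A z \<noteq> ?B z"
  \<comment> \<open>Half the gap: if both mixed derivatives vary by less than \<open>e\<close>, a
    common value at \<open>y1\<close> and \<open>y2\<close> is impossible.\<close>
  define e where "e = \<bar>?A z - ?B z\<bar> / 2"
  have "e > 0" using ne by (simp add: e_def)
  have "isCont ?A z" "isCont ?B z"
    using cont assms(1,2) by (auto simp: continuous_on_eq_continuous_at)
  then obtain d1 d2 where d1: "d1 > 0" "\<And>y. dist y z < d1 \<Longrightarrow> dist (?A y) (?A z) < e"
    and d2: "d2 > 0" "\<And>y. dist y z < d2 \<Longrightarrow> dist (?B y) (?B z) < e"
    unfolding continuous_at_eps_delta using \<open>e > 0\<close> by metis
  obtain d3 where d3: "d3 > 0" "ball z d3 \<subseteq> D"
    using assms(1,2) openE by blast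
  define d where "d = min d1 (min d2 d3)"
  have d: "d > 0" "ball z d \<subseteq> D"
    using d1(1) d2(1) d3 by (auto simp: d_def)
  \<comment> \<open>The summand 1 keeps the denominator positive even for \<open>v = w = 0\<close>
    and makes both steps together strictly shorter than \<open>d\<close>.\<close>
  define r where "r = d / (norm v + norm w + 1)"
  have "norm v + norm w + 1 > 0"
    using norm_ge_zero[of v] norm_ge_zero[of w] by linarith
  then have r: "r > 0" "r * norm v + r * norm w < d" "r * norm w + r * norm v < d"
proof -
    assume pos: "norm v + norm w + 1 > 0"
    then show "r > 0" using d(1) by (simp add: r_def)
    have "r * (norm v + norm w + 1) = d"
      using pos by (simp add: r_def)
    with \<open>r > 0\<close> show "r * norm v + r * norm w < d" "r * norm w + r * norm v < d"
      by (simp_all add: distrib_left)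
  qed
  obtain y1 where y1: "y1 \<in> ball z d"
    "u (z + of_real r * v + of_real r * w) - u (z + of_real r * v) - u (z + of_real r * w) + u z = r\<^sup>2 * ?A y1"
    using second_difference_mvt[of z d u v r w] u uv d(2) r by blast
  obtain y2 where y2: "y2 \<in> ball z d"
    "u (z + of_real r * w + of_real r * v) - u (z + of_real r * w) - u (z + of_real r * v) + u z = r\<^sup>2 * ?B y2"
    using second_difference_mvt[of z d u w r v] u uw d(2) r by blast
  have "r\<^sup>2 * ?A y1 = r\<^sup>2 * ?B y2"
    unfolding y1(2)[symmetric] y2(2)[symmetric] by (simp add: add_ac)
  then have "?A y1 = ?B y2" using r by simp
  moreover have "dist (?A y1) (?A z) < e" "dist (?B y2) (?B z) < e"
    using d1(2)[of y1] d2(2)[of y2] y1(1) y2(1) by (auto simp: d_def dist_commute)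
  ultimately show False
    by (auto simp: e_def dist_real_def abs_if split: if_splits)
qed

section \<open>Harmonic functions as real parts of holomorphic functions\<close>

text \<open>Twice the Wirtinger derivative of \<open>u\<close> with respect to \<open>z\<close>. The
  minus sign makes the differential of \<open>u\<close> the real part of a complex product, and
  \<open>cgrad u\<close> equal to \<open>F'\<close> whenever \<open>u = Re F\<close> with
  \<open>F\<close> holomorphic.\<close>

definition cgrad :: "(complex \<Rightarrow> real) \<Rightarrow> complex \<Rightarrow> complex" where
  "cgrad u z = Complex (dirderiv 1 u z) (- dirderiv \<i> u z)"

lemma frechet_derivative_cgrad:
  assumes "u differentiable (at z)"
  shows "frechet_derivative u (at z) h = Re (cgrad u z * h)"
proof -
  have lin: "linear (frechet_derivative u (at z))"
    using assms linear_frechet_derivative by blast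
  have h: "h = Re h *\<^sub>R 1 + Im h *\<^sub>R \<i>"
    by (simp add: complex_eq_iff)
  show ?thesis
    by (subst h) (simp add: linear_add[OF lin] linear_scale[OF lin] cgrad_def dirderiv_def)
qed

lemma has_derivative_cgrad:
  assumes "u differentiable (at z)"
  shows "(u has_derivative (\<lambda>h. Re (cgrad u z * h))) (at z)"
proof -
  have "frechet_derivative u (at z) = (\<lambda>h. Re (cgrad u z * h))"
    by (rule ext) (rule frechet_derivative_cgrad[OF assms])
  then show ?thesis
    using assms frechet_derivative_works[of u "at z"] by simp
qed

lemma real_harmonic_onD:
  assumes "real_harmonic_on u D" "open D" "z \<in> D"
  shows "u differentiable (at z)" "dirderiv 1 u differentiable (at z)" "dirderiv \<i> u differentiable (at z)"
  using assms by (auto simp: real_harmonic_on_def differentiable_on_eq_differentiable_at)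

text \<open>The Cauchy--Riemann equations for \<open>cgrad u\<close> are the Laplace equation and
  the symmetry of the mixed derivatives; under them its real differential is multiplication by a
  complex number.\<close>

lemma holomorphic_on_cgrad:
  assumes u: "real_harmonic_on u D" and "open D"
  shows "cgrad u holomorphic_on D"
  unfolding holomorphic_on_open[OF \<open>open D\<close>]
proof (intro ballI exI)
  fix z assume z: "z \<in> D"
  note d = real_harmonic_onD[OF u \<open>open D\<close>]
  let ?a = "dirderiv 1 (dirderiv 1 u) z" and ?b = "dirderiv 1 (dirderiv \<i> u) z"
  have comm: "dirderiv \<i> (dirderiv 1 u) z = ?b"
    using u by (intro dirderiv_commute[OF \<open>open D\<close> z d]) (auto simp: real_harmonic_on_def)
  have lap: "dirderiv \<i> (dirderiv \<i> u) z = - ?a"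
    using u z by (auto simp: real_harmonic_on_def)
  have "(cgrad u has_derivative (\<lambda>h. of_real (Re (cgrad (dirderiv 1 u) z * h))
      - \<i> * of_real (Re (cgrad (dirderiv \<i> u) z * h)))) (at z)"
    unfolding cgrad_def[of u, abs_def] Complex_eq of_real_minus mult_minus_right add_uminus_conv_diff
    by (intro derivative_intros has_derivative_cgrad d z)
  moreover have "(\<lambda>h. of_real (Re (cgrad (dirderiv 1 u) z * h)) - \<i> * of_real (Re (cgrad (dirderiv \<i> u) z * h)))
      = (*) (Complex ?a (- ?b))"
    by (rule ext) (simp add: cgrad_def comm lap complex_eq_iff)
  ultimately show "(cgrad u has_field_derivative Complex ?a (- ?b)) (at z)"
    by (simp add: has_field_derivative_def)
qed

text \<open>On the convex set \<open>S\<close> the holomorphic function \<open>?g\<close> has a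
  primitive, whose real part has the same differential as \<open>u \<circ> p\<close>, so the two
  differ by a constant. Pulling back avoids periods: on \<open>D\<close> itself a harmonic conjugate
  may be multivalued.\<close>

lemma harmonic_comp_eq_Re_holomorphic:
  assumes u: "real_harmonic_on u D" and "open D"
    and S: "open S" "convex S" and p: "p holomorphic_on S" "p ` S \<subseteq> D"
    and s: "s \<in> S" and w: "Re w = u (p s)"
  obtains F where "F holomorphic_on S" "F s = w" "\<And>x. x \<in> S \<Longrightarrow> Re (F x) = u (p x)"
    "deriv F s = cgrad u (p s) * deriv p s"
proof -
  let ?g = "\<lambda>x. cgrad u (p x) * deriv p x"
  have "(cgrad u \<circ> p) holomorphic_on S"
    using holomorphic_on_compose_gen[OF p(1) holomorphic_on_cgrad[OF u \<open>open D\<close>] p(2)] .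
  then have "?g holomorphic_on S"
    using p(1) S(1) by (intro holomorphic_intros holomorphic_deriv) (auto simp: o_def)
  then obtain F0 where F0: "\<And>x. x \<in> S \<Longrightarrow> (F0 has_field_derivative ?g x) (at x within S)"
    using holomorphic_convex_primitive'[OF S(2,1), of ?g] by auto
  \<comment> \<open>This normalisation gives \<open>F s = w\<close>; the condition on
    \<open>w\<close> fixes only its real part, so the imaginary part may be prescribed
    freely.\<close>
  define F where "F x = F0 x - F0 s + w" for x
  have F: "(F has_field_derivative ?g x) (at x)" if "x \<in> S" for x
    unfolding F_def using F0[OF that] at_within_open[OF that S(1)]
    by (auto intro!: derivative_eq_intros)
  have "((\<lambda>x. Re (F x) - u (p x)) has_derivative (\<lambda>h. 0)) (at x within S)" if x: "x \<in> S" for x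
  proof -
    have "u differentiable (at (p x))"
      using real_harmonic_onD(1)[OF u \<open>open D\<close>] p(2) x by blast
    then have "(u has_derivative (\<lambda>h. Re (cgrad u (p x) * h))) (at (p x))"
      by (rule has_derivative_cgrad)
    moreover have "(p has_derivative (*) (deriv p x)) (at x)"
      using holomorphic_derivI[OF p(1) S(1) x] by (simp add: has_field_derivative_def)
    ultimately have "((\<lambda>x. u (p x)) has_derivative (\<lambda>h. Re (cgrad u (p x) * (deriv p x * h)))) (at x)"
      by (rule has_derivative_compose[rotated])
    moreover have "((\<lambda>x. Re (F x)) has_derivative (\<lambda>h. Re (?g x * h))) (at x)"
      using F[OF x] by (intro bounded_linear.has_derivative[OF bounded_linear_Re]) (simp add: has_field_derivative_def)
    ultimately have "((\<lambda>x. Re (F x) - u (p x)) has_derivative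
        (\<lambda>h. Re (?g x * h) - Re (cgrad u (p x) * (deriv p x * h)))) (at x)"
      by (rule has_derivative_diff[rotated])
    then have "((\<lambda>x. Re (F x) - u (p x)) has_derivative (\<lambda>h. 0)) (at x)"
      by (simp only: mult.assoc diff_self)
    then show ?thesis
      by (rule has_derivative_at_withinI)
  qed
  then obtain c where c: "\<And>x. x \<in> S \<Longrightarrow> Re (F x) - u (p x) = c"
    using has_derivative_zero_constant[OF S(2), of "\<lambda>x. Re (F x) - u (p x)"] by auto
  show thesis
  proof
    show "F holomorphic_on S"
      using F S(1) holomorphic_on_open by blast
    show Fs: "F s = w" by (simp add: F_def)
    show "Re (F x) = u (p x)" if "x \<in> S" for x
      using c[OF that] c[OF s] w Fs by simp
    show "deriv F s = ?g s"
      using F[OF s] by (rule DERIV_imp_deriv)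
  qed
qed

text \<open>The holomorphic \<open>F\<close> with real part \<open>u \<circ> p\<close> maps the disc
  into the strip, since membership depends on the real part alone, and it takes the value
  \<open>w\<close> at a point \<open>s\<close> over \<open>z\<close>. There \<open>|F'|\<close> is
  \<open>|cgrad u z| |p'(s)|\<close>, and the factor \<open>|p'(s)|\<close> turns the density of the
  disc into that of \<open>D\<close>.\<close>

lemma harmonic_contraction:
  assumes D: "hyperbolic_domain D" and "ereal a < b"
    and u: "real_harmonic_on u D" and im: "\<And>x. x \<in> D \<Longrightarrow> a < u x \<and> ereal (u x) < b"
    and z: "z \<in> D" and w: "Re w = u z"
  shows "\<bar>frechet_derivative u (at z) h\<bar> * hyp_density (strip a b) w \<le> hyp_density D z * norm h"
proof -
  obtain p where p: "disc_covering p D" and "open D"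
    using D by (auto simp: hyperbolic_domain_def)
  note p' = disc_coveringD[OF p]
  obtain s where s: "s \<in> ball 0 1" "z = p s"
    using z p'(3) by blast
  obtain F where F: "F holomorphic_on ball 0 1" "F s = w" "\<And>x. x \<in> ball 0 1 \<Longrightarrow> Re (F x) = u (p x)"
    "deriv F s = cgrad u (p s) * deriv p s"
    by (rule harmonic_comp_eq_Re_holomorphic[OF u \<open>open D\<close> open_ball convex_ball p'(1) _ s(1)])
       (use p'(3) w s(2) in auto)
  have G: "hyperbolic_domain (strip a b)"
    using \<open>ereal a < b\<close> by (rule hyperbolic_domain_strip)
  have wG: "w \<in> strip a b"
    using im[OF z] w by (simp add: strip_def)
  have "F ` ball 0 1 \<subseteq> strip a b"
    using F(3) im p'(3) by (auto simp: strip_def)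
  from hyp_density_contraction[OF F(1) this G s(1)]
  have "norm (cgrad u z) * norm (deriv p s) * hyp_density (strip a b) w \<le> disc_density s"
    by (simp add: F(2,4) norm_mult s(2))
  then have *: "norm (cgrad u z) * hyp_density (strip a b) w \<le> hyp_density D z"
    using deriv_disc_covering_nonzero[OF p s(1)]
    unfolding s(2) hyp_density_disc_covering[OF p s(1)] by (simp add: pos_le_divide_eq mult_ac)
  have "\<bar>frechet_derivative u (at z) h\<bar> \<le> norm (cgrad u z) * norm h"
    unfolding frechet_derivative_cgrad[OF real_harmonic_onD(1)[OF u \<open>open D\<close> z]]
    using abs_Re_le_cmod[of "cgrad u z * h"] by (simp add: norm_mult)
  then have "\<bar>frechet_derivative u (at z) h\<bar> * hyp_density (strip a b) w
      \<le> norm (cgrad u z) * norm h * hyp_density (strip a b) w"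
    using hyp_density_pos[OF G wG] by (intro mult_right_mono) auto
  also have "\<dots> \<le> hyp_density D z * norm h"
    using mult_right_mono[OF *, of "norm h"] by (simp add: mult_ac)
  finally show ?thesis .
qed

section \<open>Piecewise smooth paths and hyperbolic length\<close>

lemma partition_interval_subset:
  fixes t :: "nat \<Rightarrow> real"
  assumes "\<And>i. i < n \<Longrightarrow> t i < t (Suc i)" and "i < n"
  shows "{t i..t (Suc i)} \<subseteq> {t 0..t n}"
proof -
  have le: "t 0 \<le> t j" if "j \<le> n" for j
    using that
  proof (induction j)
    case (Suc j)
    then show ?case using assms(1)[of j] by simp
  qed simp
  have "t (Suc i) \<le> t n"
    using Suc_leI[OF assms(2)]
  proof (induction rule: inc_induct)
    case (step m)
    then show ?case using assms(1)[of m] by simp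
  qed simp
  then show ?thesis
    using le[of i] assms(2) by auto
qed

text \<open>The integrands are compared through continuous substitutes that agree with them inside
  each piece: at break points a path may lack a derivative, and finitely many exceptional values do
  not affect the integrals.\<close>

lemma partition_integral_le:
  fixes \<phi> \<psi> :: "real \<Rightarrow> real" and t :: "nat \<Rightarrow> real"
  assumes t: "\<And>i. i < n \<Longrightarrow> t i < t (Suc i)"
    and pieces: "\<And>i. i < n \<Longrightarrow> \<exists>\<phi>' \<psi>'. continuous_on {t i..t (Suc i)} \<phi>' \<and> continuous_on {t i..t (Suc i)} \<psi>' \<and>
      (\<forall>x\<in>{t i<..<t (Suc i)}. \<phi> x = \<phi>' x \<and> \<psi> x = \<psi>' x) \<and> (\<forall>x\<in>{t i..t (Suc i)}. \<phi>' x \<le> \<psi>' x)"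
  shows "integral {t 0..t n} \<phi> \<le> integral {t 0..t n} \<psi>"
proof -
  \<comment> \<open>Integrability is carried through the induction because splitting the integrals
    at \<open>t m\<close> requires it.\<close>
  have "\<phi> integrable_on {t 0..t m} \<and> \<psi> integrable_on {t 0..t m} \<and>
      integral {t 0..t m} \<phi> \<le> integral {t 0..t m} \<psi>" if "m \<le> n" for m
    using that
  proof (induction m)
    case 0
    then show ?case using integrable_on_refl[of \<phi> "t 0"] integrable_on_refl[of \<psi> "t 0"] by simp
  next
    case (Suc m)
    let ?I = "{t m..t (Suc m)}"
    obtain \<phi>' \<psi>' where c: "continuous_on ?I \<phi>'" "continuous_on ?I \<psi>'"
      and eq: "\<And>x. x \<in> {t m<..<t (Suc m)} \<Longrightarrow> \<phi> x = \<phi>' x \<and> \<psi> x = \<psi>' x"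
      and le: "\<And>x. x \<in> ?I \<Longrightarrow> \<phi>' x \<le> \<psi>' x"
      using pieces[of m] Suc.prems by (metis Suc_le_eq)
    have int': "\<phi>' integrable_on ?I" "\<psi>' integrable_on ?I"
      using c by (auto intro: integrable_continuous_interval)
    have eq': "\<phi> x = \<phi>' x" "\<psi> x = \<psi>' x" if "x \<in> ?I - {t m, t (Suc m)}" for x
      using eq[of x] that by auto
    have int: "\<phi> integrable_on ?I" "\<psi> integrable_on ?I"
      using integrable_spike_finite[of "{t m, t (Suc m)}" ?I] int' eq' by blast+
    have "integral ?I \<phi> = integral ?I \<phi>'"
      by (rule integral_spike[of "{t m, t (Suc m)}"]) (simp, rule eq'(1)[symmetric])
    moreover have "integral ?I \<psi> = integral ?I \<psi>'"
      by (rule integral_spike[of "{t m, t (Suc m)}"]) (simp, rule eq'(2)[symmetric])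
    moreover have "integral ?I \<phi>' \<le> integral ?I \<psi>'"
      using int' le by (rule integral_le)
    ultimately have le': "integral ?I \<phi> \<le> integral ?I \<psi>" by simp
    have ord: "t 0 \<le> t m" "t m \<le> t (Suc m)"
      using partition_interval_subset[of n t m] t Suc.prems by (auto simp: Suc_le_eq less_imp_le)
    have IH: "\<phi> integrable_on {t 0..t m}" "\<psi> integrable_on {t 0..t m}"
        "integral {t 0..t m} \<phi> \<le> integral {t 0..t m} \<psi>"
      using Suc by auto
    show ?case
      using Henstock_Kurzweil_Integration.integral_combine[OF ord, of \<phi>]
        Henstock_Kurzweil_Integration.integral_combine[OF ord, of \<psi>]
        Henstock_Kurzweil_Integration.integrable_combine[OF ord IH(1) int(1)]
        Henstock_Kurzweil_Integration.integrable_combine[OF ord IH(2) int(2)] IH(3) le'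
      by linarith
  qed
  then show ?thesis by blast
qed

text \<open>Joint continuity of \<open>L\<close> in point and direction expresses continuous
  differentiability of \<open>f\<close>; it makes the chain-rule derivative
  \<open>L (g x) (g' x)\<close> continuous on each closed piece.\<close>

lemma piecewise_smooth_path_comp:
  assumes g: "piecewise_smooth_path g" "path_image g \<subseteq> D"
    and f: "\<And>z. z \<in> D \<Longrightarrow> (f has_derivative L z) (at z)"
    and L: "continuous_on (D \<times> UNIV) (\<lambda>(z, h). L z h)"
  shows "piecewise_smooth_path (f \<circ> g)"
proof -
  obtain n t where t: "t 0 = 0" "t n = 1" "\<And>i. i < n \<Longrightarrow> t i < t (Suc i)"
    and pieces: "\<And>i. i < n \<Longrightarrow> \<exists>g'. continuous_on {t i..t (Suc i)} g' \<and>
           (\<forall>x\<in>{t i..t (Suc i)}. (g has_vector_derivative g' x) (at x within {t i..t (Suc i)}))"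
    using g(1) unfolding piecewise_smooth_path_def by auto
  have "\<exists>k. continuous_on {t i..t (Suc i)} k \<and> (\<forall>x\<in>{t i..t (Suc i)}.
      ((f \<circ> g) has_vector_derivative k x) (at x within {t i..t (Suc i)}))" if i: "i < n" for i
  proof -
    let ?I = "{t i..t (Suc i)}"
    obtain g' where g': "continuous_on ?I g'"
      and d: "\<And>x. x \<in> ?I \<Longrightarrow> (g has_vector_derivative g' x) (at x within ?I)"
      using pieces[OF i] by auto
    have gD: "g x \<in> D" if "x \<in> ?I" for x
      using partition_interval_subset[of n t i] t i g(2) that by (auto simp: path_image_def)
    have cg: "continuous_on ?I g"
      using d by (rule continuous_on_vector_derivative)
    have "continuous_on ?I (\<lambda>x. (\<lambda>(z, h). L z h) (g x, g' x))"
      using gD by (intro continuous_on_compose2[OF L] continuous_intros cg g') auto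
    moreover have "((f \<circ> g) has_vector_derivative L (g x) (g' x)) (at x within ?I)" if "x \<in> ?I" for x
      using vector_derivative_diff_chain_within[OF d[OF that]] f[OF gD[OF that]] has_derivative_at_withinI by blast
    ultimately show ?thesis by auto
  qed
  then show ?thesis
    unfolding piecewise_smooth_path_def using t by auto
qed

lemma hyp_length_comp_le:
  assumes D: "hyperbolic_domain D" and G: "hyperbolic_domain G" and im: "f ` D \<subseteq> G"
    and f: "\<And>z. z \<in> D \<Longrightarrow> (f has_derivative L z) (at z)"
    and L: "continuous_on (D \<times> UNIV) (\<lambda>(z, h). L z h)"
    and le: "\<And>z h. z \<in> D \<Longrightarrow> hyp_density G (f z) * norm (L z h) \<le> hyp_density D z * norm h"
    and g: "piecewise_smooth_path g" "path_image g \<subseteq> D"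
  shows "hyp_length G (f \<circ> g) \<le> hyp_length D g"
proof -
  obtain n t where t: "t 0 = 0" "t n = 1" "\<And>i. i < n \<Longrightarrow> t i < t (Suc i)"
    and pieces: "\<And>i. i < n \<Longrightarrow> \<exists>g'. continuous_on {t i..t (Suc i)} g' \<and>
           (\<forall>x\<in>{t i..t (Suc i)}. (g has_vector_derivative g' x) (at x within {t i..t (Suc i)}))"
    using g(1) unfolding piecewise_smooth_path_def by auto
  let ?\<phi> = "\<lambda>x. hyp_density G ((f \<circ> g) x) * norm (vector_derivative (f \<circ> g) (at x within {0..1}))"
  let ?\<psi> = "\<lambda>x. hyp_density D (g x) * norm (vector_derivative g (at x within {0..1}))"
  have "integral {t 0..t n} ?\<phi> \<le> integral {t 0..t n} ?\<psi>"
  proof (rule partition_integral_le)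
    show "t i < t (Suc i)" if "i < n" for i using t(3) that .
  next
    fix i assume i: "i < n"
    let ?I = "{t i..t (Suc i)}"
    obtain g' where g': "continuous_on ?I g'"
      and d: "\<And>x. x \<in> ?I \<Longrightarrow> (g has_vector_derivative g' x) (at x within ?I)"
      using pieces[OF i] by auto
    have I: "?I \<subseteq> {0..1}"
      using partition_interval_subset[of n t i] t i by auto
    have gD: "g x \<in> D" if "x \<in> ?I" for x
      using I g(2) that by (auto simp: path_image_def)
    have cg: "continuous_on ?I g"
      using d by (rule continuous_on_vector_derivative)
    have cf: "continuous_on D f"
      using f has_derivative_continuous continuous_at_imp_continuous_on by blast
    have "continuous_on ?I (\<lambda>x. (\<lambda>(z, h). L z h) (g x, g' x))"
      using gD by (intro continuous_on_compose2[OF L] continuous_intros cg g') auto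
    then have cL: "continuous_on ?I (\<lambda>x. L (g x) (g' x))" by simp
    \<comment> \<open>The substitutes use the derivative \<open>g'\<close> belonging to the piece,
      one-sided at its endpoints, in place of \<open>vector_derivative\<close> relative to
      \<open>{0..1}\<close>, which may have no meaning at a break point.\<close>
    let ?\<phi>' = "\<lambda>x. hyp_density G (f (g x)) * norm (L (g x) (g' x))"
    let ?\<psi>' = "\<lambda>x. hyp_density D (g x) * norm (g' x)"
    have "continuous_on ?I ?\<phi>'"
      using gD im by (intro continuous_intros cL continuous_on_compose2[OF continuous_on_hyp_density[OF G]]
          continuous_on_compose2[OF cf cg]) auto
    moreover have "continuous_on ?I ?\<psi>'"
      using gD by (intro continuous_intros g' continuous_on_compose2[OF continuous_on_hyp_density[OF D] cg]) auto
    moreover have "?\<phi> x = ?\<phi>' x \<and> ?\<psi> x = ?\<psi>' x" if x: "x \<in> {t i<..<t (Suc i)}" for x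
    proof -
      have xI: "x \<in> ?I" and x01: "x \<in> {0..1}" using x I by auto
      \<comment> \<open>Strictly inside a piece the derivative relative to the piece is two-sided,
        hence also the derivative relative to \<open>{0..1}\<close>.\<close>
      have at: "at x within ?I = at x"
        using x by (intro at_within_interior) (simp add: interior_atLeastAtMost_real)
      have dg: "(g has_vector_derivative g' x) (at x)"
        using d[OF xI] unfolding at .
      have vd: "vector_derivative k (at x within {0..1}) = k'"
        if "(k has_vector_derivative k') (at x)" for k :: "real \<Rightarrow> complex" and k'
        using x01 by (intro vector_derivative_within_closed_interval has_vector_derivative_at_within[OF that]) auto
      have "((f \<circ> g) has_vector_derivative L (g x) (g' x)) (at x)"
        by (rule vector_derivative_diff_chain_within[OF dg has_derivative_at_withinI[OF f[OF gD[OF xI]]]])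
      then show ?thesis
        using vd vd[OF dg] by simp
    qed
    ultimately show "\<exists>\<phi>' \<psi>'. continuous_on ?I \<phi>' \<and> continuous_on ?I \<psi>' \<and>
        (\<forall>x\<in>{t i<..<t (Suc i)}. ?\<phi> x = \<phi>' x \<and> ?\<psi> x = \<psi>' x) \<and> (\<forall>x\<in>?I. \<phi>' x \<le> \<psi>' x)"
      using le gD by (intro exI[of _ ?\<phi>'] exI[of _ ?\<psi>'] conjI ballI) auto
  qed
  then show ?thesis
    by (simp add: hyp_length_def t(1,2))
qed

section \<open>Hyperbolic distance\<close>

lemma hyp_length_nonneg:
  assumes "hyperbolic_domain D" "path_image g \<subseteq> D"
  shows "hyp_length D g \<ge> 0"
proof -
  let ?k = "\<lambda>t. hyp_density D (g t) * norm (vector_derivative g (at t within {0..1}))"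
  have "0 \<le> ?k t" if "t \<in> {0..1}" for t
  proof -
    have "g t \<in> D" using assms(2) that by (auto simp: path_image_def)
    then show ?thesis using hyp_density_pos[OF assms(1)] by (simp add: less_imp_le)
  qed
  \<comment> \<open>If the integrand is not integrable, its integral is 0 by convention, which still
    satisfies the bound.\<close>
  then have "0 \<le> integral {0..1} ?k"
    by (cases "?k integrable_on {0..1}") (auto intro: integral_nonneg simp: not_integrable_integral)
  then show ?thesis by (simp add: hyp_length_def)
qed

text \<open>The \<open>p\<close>-image of a straight segment in the disc is such a path. It makes
  the infimum in \<open>hyp_dist\<close> range over a nonempty set.\<close>

lemma piecewise_smooth_path_exists:
  assumes "hyperbolic_domain D" "z1 \<in> D" "z2 \<in> D"
  obtains g where "piecewise_smooth_path g" "path_image g \<subseteq> D" "pathstart g = z1" "pathfinish g = z2"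
proof -
  obtain p where p: "disc_covering p D"
    using assms(1) by (auto simp: hyperbolic_domain_def)
  note p' = disc_coveringD[OF p]
  obtain s1 s2 where s: "s1 \<in> ball 0 1" "z1 = p s1" "s2 \<in> ball 0 1" "z2 = p s2"
    using assms p'(3) by blast
  let ?l = "linepath s1 s2"
  have l: "path_image ?l \<subseteq> ball 0 1"
    using s by (simp add: closed_segment_subset del: mem_ball)
  have "(?l has_vector_derivative s2 - s1) (at x within S)" for x S
    by (rule has_vector_derivative_linepath_within)
  \<comment> \<open>A single piece: \<open>n = 1\<close> with break points \<open>real 0\<close> and
    \<open>real 1\<close>.\<close>
  then have "piecewise_smooth_path ?l"
    unfolding piecewise_smooth_path_def
    by (intro exI[of _ 1] exI[of _ real]) (auto intro!: exI[of _ "\<lambda>_. s2 - s1"])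
  moreover have "(p has_derivative (*) (deriv p x)) (at x)" if "x \<in> ball 0 1" for x
    using holomorphic_derivI[OF p'(1) open_ball that] by (simp add: has_field_derivative_def)
  moreover have "continuous_on (ball 0 1 \<times> UNIV) (\<lambda>(x, h). deriv p x * h)"
    unfolding case_prod_unfold
    by (intro continuous_intros continuous_on_compose2[OF holomorphic_on_imp_continuous_on[OF holomorphic_deriv[OF p'(1) open_ball]]]) auto
  ultimately have "piecewise_smooth_path (p \<circ> ?l)"
    by (rule piecewise_smooth_path_comp[OF _ l])
  moreover have "path_image (p \<circ> ?l) \<subseteq> D"
    using l p'(3) by (auto simp: path_image_compose)
  ultimately show thesis
    using that[of "p \<circ> ?l"] s by (simp add: pathstart_compose pathfinish_compose)
qed

text \<open>Every path \<open>g\<close> in \<open>D\<close> yields the competitor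
  \<open>f \<circ> g\<close> in \<open>G\<close>, which is no longer than \<open>g\<close>.
  Comparing infima of reals also requires that some path in \<open>D\<close> exists and that lengths
  in \<open>G\<close> are bounded below.\<close>

lemma hyp_dist_contraction:
  assumes D: "hyperbolic_domain D" and G: "hyperbolic_domain G" and im: "f ` D \<subseteq> G"
    and f: "\<And>z. z \<in> D \<Longrightarrow> (f has_derivative L z) (at z)"
    and L: "continuous_on (D \<times> UNIV) (\<lambda>(z, h). L z h)"
    and le: "\<And>z h. z \<in> D \<Longrightarrow> hyp_density G (f z) * norm (L z h) \<le> hyp_density D z * norm h"
    and z: "z1 \<in> D" "z2 \<in> D"
  shows "hyp_dist G (f z1) (f z2) \<le> hyp_dist D z1 z2"
  unfolding hyp_dist_def
proof (rule cINF_mono)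
  show "{g. piecewise_smooth_path g \<and> path_image g \<subseteq> D \<and> pathstart g = z1 \<and> pathfinish g = z2} \<noteq> {}"
    using piecewise_smooth_path_exists[OF D z] by auto
  show "bdd_below (hyp_length G ` {g. piecewise_smooth_path g \<and> path_image g \<subseteq> G \<and>
      pathstart g = f z1 \<and> pathfinish g = f z2})"
    using hyp_length_nonneg[OF G] by (intro bdd_belowI2[of _ 0]) auto
next
  fix g assume "g \<in> {g. piecewise_smooth_path g \<and> path_image g \<subseteq> D \<and> pathstart g = z1 \<and> pathfinish g = z2}"
  then have g: "piecewise_smooth_path g" "path_image g \<subseteq> D" "pathstart g = z1" "pathfinish g = z2"
    by auto
  have "piecewise_smooth_path (f \<circ> g)"
    by (rule piecewise_smooth_path_comp[OF g(1,2) f L])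
  moreover have "path_image (f \<circ> g) \<subseteq> G"
    using g(2) im by (auto simp: path_image_compose)
  moreover have "hyp_length G (f \<circ> g) \<le> hyp_length D g"
    by (rule hyp_length_comp_le[OF D G im f L le g(1,2)])
  ultimately show "\<exists>k\<in>{g. piecewise_smooth_path g \<and> path_image g \<subseteq> G \<and>
      pathstart g = f z1 \<and> pathfinish g = f z2}. hyp_length G k \<le> hyp_length D g"
    using g(3,4) by (intro bexI[of _ "f \<circ> g"]) (auto simp: pathstart_compose pathfinish_compose)
qed

section \<open>Directional and metric estimates for harmonic maps into a strip\<close>

theorem theorem2:
  fixes D G :: "complex set" and a :: real and b :: ereal and f :: "complex \<Rightarrow> complex"
  assumes "hyperbolic_domain D"
    and "ereal a < b"
    and "G = strip a b"
    and "complex_harmonic_on f D"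
    and "f ` D \<subseteq> G"
  shows "(\<forall>z\<in>D. \<forall>h v :: complex. \<forall>\<mu> :: real.
            norm h = 1 \<and> \<mu> > 0 \<and> norm v = 1 \<and>
            frechet_derivative f (at z) h = \<mu> *\<^sub>R v \<longrightarrow>
              \<mu> * cos (vec_angle v 1) * hyp_density G (f z) \<le> hyp_density D z \<and>
              (f ` D \<subseteq> \<real> \<longrightarrow> \<mu> * hyp_density G (f z) \<le> hyp_density D z))
       \<and> (f ` D \<subseteq> \<real> \<longrightarrow>
            (\<forall>z1\<in>D. \<forall>z2\<in>D. hyp_dist G (f z1) (f z2) \<le> hyp_dist D z1 z2))"
proof -
  let ?u = "\<lambda>z. Re (f z)" and ?v = "\<lambda>z. Im (f z)"
  have "open D" using assms(1) by (simp add: hyperbolic_domain_def)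
  have G: "hyperbolic_domain G"
    unfolding assms(3) using assms(2) by (rule hyperbolic_domain_strip)
  have u: "real_harmonic_on ?u D" and v: "real_harmonic_on ?v D"
    using assms(4) by (auto simp: complex_harmonic_on_def)
  \<comment> \<open>The point \<open>w\<close> of the strip is taken to be \<open>f z\<close>, so
    the condition on its real part holds by reflexivity.\<close>
  have contr: "\<bar>Re (cgrad ?u z * h)\<bar> * hyp_density G (f z) \<le> hyp_density D z * norm h"
    if z: "z \<in> D" for z h
    using harmonic_contraction[OF assms(1,2) u _ z refl, of h] assms(5)
      frechet_derivative_cgrad[OF real_harmonic_onD(1)[OF u \<open>open D\<close> z], of h]
    by (auto simp: assms(3) strip_def image_subset_iff)
  have f: "(f has_derivative (\<lambda>h. of_real (Re (cgrad ?u z * h)) + \<i> * of_real (Re (cgrad ?v z * h)))) (at z)"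
    if z: "z \<in> D" for z
  proof -
    have "((\<lambda>x. of_real (?u x) + \<i> * of_real (?v x)) has_derivative
        (\<lambda>h. of_real (Re (cgrad ?u z * h)) + \<i> * of_real (Re (cgrad ?v z * h)))) (at z)"
      by (intro derivative_intros has_derivative_cgrad real_harmonic_onD(1)[OF _ \<open>open D\<close> z] u v)
    then show ?thesis by (simp flip: complex_eq)
  qed
  \<comment> \<open>For real-valued \<open>f\<close> the imaginary part vanishes on the open set
    \<open>D\<close>, so the whole differential of \<open>f\<close> is the one controlled by
    \<open>contr\<close>.\<close>
  have real: "(f has_derivative (\<lambda>h. of_real (Re (cgrad ?u z * h)))) (at z)"
    if "f ` D \<subseteq> \<real>" "z \<in> D" for z
  proof -
    have "((\<lambda>x. of_real (?u x)) has_derivative (\<lambda>h. complex_of_real (Re (cgrad ?u z * h)))) (at z)"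
      by (intro derivative_intros has_derivative_cgrad real_harmonic_onD(1)[OF u \<open>open D\<close>] that)
    then show ?thesis
      by (rule has_derivative_transform_within_open[OF _ \<open>open D\<close> that(2)]) (use that(1) in \<open>auto simp: image_subset_iff\<close>)
  qed
  have one: "\<mu> * cos (vec_angle v 1) * hyp_density G (f z) \<le> hyp_density D z \<and>
              (f ` D \<subseteq> \<real> \<longrightarrow> \<mu> * hyp_density G (f z) \<le> hyp_density D z)"
    if z: "z \<in> D" and h: "norm h = 1" and \<mu>: "\<mu> > 0" and nv: "norm v = 1"
      and df: "frechet_derivative f (at z) h = \<mu> *\<^sub>R v" for z h v :: complex and \<mu> :: real
  proof (intro conjI impI)
    have pos: "hyp_density G (f z) > 0"
      using hyp_density_pos[OF G] assms(5) z by blast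
    \<comment> \<open>The inner product of the unit vector \<open>v\<close> with 1 is
      \<open>Re v\<close>; as it lies in the domain of \<open>arccos\<close>, \<open>cos\<close>
      recovers it.\<close>
    have "\<bar>Re v\<bar> \<le> 1"
      using abs_Re_le_cmod[of v] nv by simp
    then have "cos (vec_angle v 1) = Re v"
      using nv by (simp add: vec_angle_def cos_arccos_abs)
    moreover have "\<mu> * Re v = Re (cgrad ?u z * h)"
    proof -
      have "\<mu> *\<^sub>R v = of_real (Re (cgrad ?u z * h)) + \<i> * of_real (Re (cgrad ?v z * h))"
        unfolding df[symmetric] by (rule fun_cong[OF frechet_derivative_at[OF f[OF z]], symmetric])
      from arg_cong[OF this, of Re] show ?thesis
        by simp
    qed
    \<comment> \<open>The cosine may be negative; the absolute value covers that case.\<close>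
    ultimately have "\<mu> * cos (vec_angle v 1) \<le> \<bar>Re (cgrad ?u z * h)\<bar>" by simp
    from mult_right_mono[OF this less_imp_le[OF pos]]
    show "\<mu> * cos (vec_angle v 1) * hyp_density G (f z) \<le> hyp_density D z"
      using contr[OF z, of h] h by simp
    assume "f ` D \<subseteq> \<real>"
    then have "\<mu> *\<^sub>R v = of_real (Re (cgrad ?u z * h))"
      unfolding df[symmetric] by (intro fun_cong[OF frechet_derivative_at[OF real[OF _ z]], symmetric])
    \<comment> \<open>Taking norms removes the sign: \<open>v\<close> is 1 or -1 here, and
      \<open>\<mu>\<close> is positive.\<close>
    from arg_cong[OF this, of norm] have "\<mu> = \<bar>Re (cgrad ?u z * h)\<bar>"
      unfolding norm_of_real norm_scaleR using nv \<mu> by simp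
    then show "\<mu> * hyp_density G (f z) \<le> hyp_density D z"
      using contr[OF z, of h] h by simp
  qed
  moreover have "hyp_dist G (f z1) (f z2) \<le> hyp_dist D z1 z2"
    if "f ` D \<subseteq> \<real>" "z1 \<in> D" "z2 \<in> D" for z1 z2
  proof (rule hyp_dist_contraction[OF assms(1) G assms(5) real[OF that(1)] _ _ that(2,3)])
    \<comment> \<open>Holomorphy of \<open>cgrad ?u\<close> supplies the joint continuity of the
      differential.\<close>
    have "continuous_on D (cgrad ?u)"
      by (intro holomorphic_on_imp_continuous_on holomorphic_on_cgrad u \<open>open D\<close>)
    then have "continuous_on (D \<times> UNIV) (\<lambda>x. cgrad ?u (fst x))"
      by (rule continuous_on_compose2) (auto intro: continuous_intros)
    then show "continuous_on (D \<times> UNIV) (\<lambda>(z, h). complex_of_real (Re (cgrad ?u z * h)))"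
      unfolding case_prod_unfold by (intro continuous_intros)
    show "hyp_density G (f z) * norm (complex_of_real (Re (cgrad ?u z * h))) \<le> hyp_density D z * norm h"
      if "z \<in> D" for z h
      using contr[OF that, of h] by (simp only: norm_of_real mult.commute)
  qed
  ultimately show ?thesis by blast
qed

end
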